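(* Let $R$ be a commutative ring with identity, let $A,B,C$ be $R$-algebras, let $\alpha\colon A\to B$ and $\beta\colon B\to C$ be unitary homomorphisms of $R$-algebras, let $U$ be an $A$-module and let $W$ be a $C$-module. Then: (1) $\mathrm{Res}_\alpha(\mathrm{Res}_\beta W)\cong \mathrm{Res}_{\beta\alpha}W$ as $A$-modules; (2) $\mathrm{Ind}_\beta(\mathrm{Ind}_\alpha U)\cong \mathrm{Ind}_{\beta\alpha}U$ as $C$-modules.
   Context: Modules are left modules. For a unitary homomorphism of $R$-algebras $\alpha\colon A\to B$, an $A$-module $U$ and a $B$-module $V$: the induction of $U$ via $\alpha$ is the $B$-module $\mathrm{Ind}_\alpha U = B\otimes_A U$, where $B$ is viewed as a right $A$-module via $\alpha$; the restriction of $V$ via $\alpha$ is the $A$-module $\mathrm{Res}_\alpha V$, which is $V$ with $a\in A$ acting as $\alpha(a)$. *)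

theory Defs
  imports "HOL-Algebra.Module" "HOL-Algebra.Free_Abelian_Groups"
begin

text \<open>
  The locale \<^locale>\<open>module\<close> of HOL-Algebra requires a commutative ring of scalars and the locale
  \<^locale>\<open>algebra\<close> requires a commutative algebra; the two locales below drop commutativity.
  Rings, algebras and modules are unital, but the zero ring is allowed.
  The record type \<^type>\<open>module\<close> is reused: for an algebra all of its fields are relevant, whereas
  for a module the fields \<open>mult\<close> and \<open>one\<close> are meaningless and are never referred to.
\<close>

locale left_module = ring A + M?: abelian_group M
  for A :: "('a, 'k) ring_scheme" (structure) and M :: "('a, 'm, 'x) module_scheme" (structure) +
  assumes smult_closed:
      "\<lbrakk>a \<in> carrier A; x \<in> carrier M\<rbrakk> \<Longrightarrow> a \<odot>\<^bsub>M\<^esub> x \<in> carrier M"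
    and smult_l_distr:
      "\<lbrakk>a \<in> carrier A; b \<in> carrier A; x \<in> carrier M\<rbrakk>
        \<Longrightarrow> (a \<oplus>\<^bsub>A\<^esub> b) \<odot>\<^bsub>M\<^esub> x = a \<odot>\<^bsub>M\<^esub> x \<oplus>\<^bsub>M\<^esub> b \<odot>\<^bsub>M\<^esub> x"
    and smult_r_distr:
      "\<lbrakk>a \<in> carrier A; x \<in> carrier M; y \<in> carrier M\<rbrakk>
        \<Longrightarrow> a \<odot>\<^bsub>M\<^esub> (x \<oplus>\<^bsub>M\<^esub> y) = a \<odot>\<^bsub>M\<^esub> x \<oplus>\<^bsub>M\<^esub> a \<odot>\<^bsub>M\<^esub> y"
    and smult_assoc:
      "\<lbrakk>a \<in> carrier A; b \<in> carrier A; x \<in> carrier M\<rbrakk>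
        \<Longrightarrow> (a \<otimes>\<^bsub>A\<^esub> b) \<odot>\<^bsub>M\<^esub> x = a \<odot>\<^bsub>M\<^esub> (b \<odot>\<^bsub>M\<^esub> x)"
    and smult_one:
      "x \<in> carrier M \<Longrightarrow> \<one>\<^bsub>A\<^esub> \<odot>\<^bsub>M\<^esub> x = x"

locale assoc_algebra = module R A + A?: ring A
  for R :: "('r, 'k) ring_scheme" (structure) and A :: "('r, 'a, 'x) module_scheme" (structure) +
  assumes smult_mult_left:
      "\<lbrakk>r \<in> carrier R; x \<in> carrier A; y \<in> carrier A\<rbrakk>
        \<Longrightarrow> (r \<odot>\<^bsub>A\<^esub> x) \<otimes>\<^bsub>A\<^esub> y = r \<odot>\<^bsub>A\<^esub> (x \<otimes>\<^bsub>A\<^esub> y)"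
    and smult_mult_right:
      "\<lbrakk>r \<in> carrier R; x \<in> carrier A; y \<in> carrier A\<rbrakk>
        \<Longrightarrow> x \<otimes>\<^bsub>A\<^esub> (r \<odot>\<^bsub>A\<^esub> y) = r \<odot>\<^bsub>A\<^esub> (x \<otimes>\<^bsub>A\<^esub> y)"

definition alg_hom ::
    "('r, 'k) ring_scheme \<Rightarrow> ('r, 'a, 'x) module_scheme \<Rightarrow> ('r, 'b, 'y) module_scheme
      \<Rightarrow> ('a \<Rightarrow> 'b) set"
  where \<comment> \<open>unitary, since \<^const>\<open>ring_hom\<close> demands preservation of \<open>\<one>\<close>\<close>
    "alg_hom R A B =
      {f \<in> ring_hom A B.
        \<forall>r \<in> carrier R. \<forall>x \<in> carrier A. f (r \<odot>\<^bsub>A\<^esub> x) = r \<odot>\<^bsub>B\<^esub> f x}"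

definition lmod_hom ::
    "('a, 'k) ring_scheme \<Rightarrow> ('a, 'm, 'x) module_scheme \<Rightarrow> ('a, 'n, 'y) module_scheme
      \<Rightarrow> ('m \<Rightarrow> 'n) set"
  where
    "lmod_hom A M N =
      {f \<in> carrier M \<rightarrow> carrier N.
        (\<forall>x \<in> carrier M. \<forall>y \<in> carrier M. f (x \<oplus>\<^bsub>M\<^esub> y) = f x \<oplus>\<^bsub>N\<^esub> f y) \<and>
        (\<forall>a \<in> carrier A. \<forall>x \<in> carrier M. f (a \<odot>\<^bsub>M\<^esub> x) = a \<odot>\<^bsub>N\<^esub> f x)}"

definition lmod_isomorphic ::
    "('a, 'k) ring_scheme \<Rightarrow> ('a, 'm, 'x) module_scheme \<Rightarrow> ('a, 'n, 'y) module_scheme \<Rightarrow> bool"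
  where \<comment> \<open>includes the claim that both sides are modules over \<open>A\<close> at all\<close>
    "lmod_isomorphic A M N \<longleftrightarrow>
      left_module A M \<and> left_module A N \<and>
      (\<exists>f \<in> lmod_hom A M N. bij_betw f (carrier M) (carrier N))"

text \<open>
  The tensor product \<open>M \<otimes>\<^sub>A U\<close> of a right module \<open>M\<close>, whose right action is given by the function
  \<open>ract\<close>, and a left module \<open>U\<close> is the quotient of the free abelian group on
  \<open>carrier M \<times> carrier U\<close> by the subgroup generated by the usual relations. As in
  \<^const>\<open>free_Abelian_group\<close>, the group operation is the \<open>mult\<close> field of a monoid record; on formal
  integer combinations it is addition. The element \<open>m \<otimes> u\<close> is the coset of
  \<^term>\<open>frag_of (m, u)\<close>.
\<close>

definition tensor_relations ::
    "('a, 'k) ring_scheme \<Rightarrow> ('m, 'x) ring_scheme \<Rightarrow> ('m \<Rightarrow> 'a \<Rightarrow> 'm)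
      \<Rightarrow> ('a, 'u, 'y) module_scheme \<Rightarrow> ('m \<times> 'u \<Rightarrow>\<^sub>0 int) set"
  where
    "tensor_relations A M ract U =
      {frag_of (m \<oplus>\<^bsub>M\<^esub> m', u) - frag_of (m, u) - frag_of (m', u) | m m' u.
        m \<in> carrier M \<and> m' \<in> carrier M \<and> u \<in> carrier U} \<union>
      {frag_of (m, u \<oplus>\<^bsub>U\<^esub> u') - frag_of (m, u) - frag_of (m, u') | m u u'.
        m \<in> carrier M \<and> u \<in> carrier U \<and> u' \<in> carrier U} \<union>
      {frag_of (ract m a, u) - frag_of (m, a \<odot>\<^bsub>U\<^esub> u) | m a u.
        m \<in> carrier M \<and> a \<in> carrier A \<and> u \<in> carrier U}"

definition tensor_kernel ::
    "('a, 'k) ring_scheme \<Rightarrow> ('m, 'x) ring_scheme \<Rightarrow> ('m \<Rightarrow> 'a \<Rightarrow> 'm)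
      \<Rightarrow> ('a, 'u, 'y) module_scheme \<Rightarrow> ('m \<times> 'u \<Rightarrow>\<^sub>0 int) set"
  where
    "tensor_kernel A M ract U =
      generate (free_Abelian_group (carrier M \<times> carrier U)) (tensor_relations A M ract U)"

definition tensor_group ::
    "('a, 'k) ring_scheme \<Rightarrow> ('m, 'x) ring_scheme \<Rightarrow> ('m \<Rightarrow> 'a \<Rightarrow> 'm)
      \<Rightarrow> ('a, 'u, 'y) module_scheme \<Rightarrow> ('m \<times> 'u \<Rightarrow>\<^sub>0 int) set monoid"
  where
    "tensor_group A M ract U =
      free_Abelian_group (carrier M \<times> carrier U) Mod tensor_kernel A M ract U"

definition res_mod ::
    "('a \<Rightarrow> 'b) \<Rightarrow> ('b, 'v) module \<Rightarrow> ('a, 'v) module"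
  where
    "res_mod \<alpha> V =
      \<lparr>carrier = carrier V, monoid.mult = monoid.mult V, one = one V,
       ring.zero = ring.zero V, ring.add = ring.add V,
       smult = (\<lambda>a v. \<alpha> a \<odot>\<^bsub>V\<^esub> v)\<rparr>"

text \<open>
  In \<open>ind_mod A B \<alpha> U = B \<otimes>\<^sub>A U\<close> the right action of \<open>A\<close> on \<open>B\<close> is \<open>(b, a) \<mapsto> b \<alpha>(a)\<close>. An element
  \<open>b\<close> of \<open>B\<close> acts on a coset by applying the additive extension of \<open>(b', u) \<mapsto> (b b', u)\<close> to its
  members; the kernel is then added to turn the image into a full coset again.
\<close>

definition ind_mod ::
    "('a, 'k) ring_scheme \<Rightarrow> ('b, 'l) ring_scheme \<Rightarrow> ('a \<Rightarrow> 'b) \<Rightarrow> ('a, 'u) module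
      \<Rightarrow> ('b, ('b \<times> 'u \<Rightarrow>\<^sub>0 int) set) module"
  where
    "ind_mod A B \<alpha> U =
      (let ract = (\<lambda>b a. b \<otimes>\<^bsub>B\<^esub> \<alpha> a);
           T = tensor_group A B ract U
       in \<lparr>carrier = carrier T, monoid.mult = undefined, one = undefined,
           ring.zero = one T, ring.add = monoid.mult T,
           smult = (\<lambda>b X. tensor_kernel A B ract U
             <#>\<^bsub>free_Abelian_group (carrier B \<times> carrier U)\<^esub>
               frag_extend (\<lambda>(b', u). frag_of (b \<otimes>\<^bsub>B\<^esub> b', u)) ` X)\<rparr>)"

end

theory Submission
  imports Defs
begin

text \<open>
  Restricting along \<open>\<beta>\<close> and then along \<open>\<alpha>\<close> makes \<open>a\<close> act as \<open>\<beta> (\<alpha> a)\<close>, so the two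
  restrictions are equal (\<open>res_mod_comp\<close>) and the content is that restriction yields a module at all
  (\<open>left_module_res_mod\<close>).

  For induction in stages, the key is that induction is left adjoint to restriction: an \<open>A\<close>-linear map from \<open>U\<close> to \<open>Res\<^sub>\<alpha> V\<close>
  extends along the unit \<open>u \<mapsto> 1 \<otimes> u\<close> to a \<open>B\<close>-linear map from \<open>Ind\<^sub>\<alpha> U\<close> to \<open>V\<close>
  (\<open>lmod_hom_extends\<close>), and the extension is unique because \<open>b \<otimes> u = b (1 \<otimes> u)\<close>
  (\<open>lmod_hom_ind_mod_eqI\<close>). Applying this twice, both induced modules are universal among
  \<open>C\<close>-modules \<open>V\<close> with an \<open>A\<close>-linear map from \<open>U\<close> to
  \<open>Res\<^sub>\<alpha> (Res\<^sub>\<beta> V) = Res\<^sub>\<beta>\<^sub>\<alpha> V\<close>. The extensions of each unit along the other are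
  therefore mutually inverse; on tensors they are \<open>c \<otimes> (b \<otimes> u) \<mapsto> c \<beta>(b) \<otimes> u\<close> and
  \<open>c \<otimes> u \<mapsto> c \<otimes> (1 \<otimes> u)\<close>.

  Most of the work is to extract the adjunction from the construction of the tensor product as a
  quotient of a free abelian group. One principle recurs: a homomorphism out of the free group that
  respects the three kinds of relations kills the whole kernel
  (\<open>balanced_imp_K_subset_kernel\<close>), and two homomorphisms out of the quotient are equal once they
  agree on pure tensors (\<open>additive_eqI\<close>). The first makes multiplication by \<open>b\<close> on cosets and the
  extension of linear maps well defined; the second gives most of the module axioms, the linearity of the
  extension and its uniqueness.
\<close>

section \<open>Homomorphisms on free abelian groups\<close>

lemma hom_free_Abelian_group_eqI:
  assumes "group G" "h \<in> hom (free_Abelian_group S) G" "h' \<in> hom (free_Abelian_group S) G"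
    and eq: "\<And>s. s \<in> S \<Longrightarrow> h (frag_of s) = h' (frag_of s)"
    and x: "Poly_Mapping.keys x \<subseteq> S"
  shows "h x = h' x"
proof -
  interpret h: group_hom "free_Abelian_group S" G h
    using assms by (simp add: group_hom_def group_hom_axioms_def)
  interpret h': group_hom "free_Abelian_group S" G h'
    using assms by (simp add: group_hom_def group_hom_axioms_def)
  have diff: "k (x - y) = k x \<otimes>\<^bsub>G\<^esub> inv\<^bsub>G\<^esub> k y"
    if "k \<in> hom (free_Abelian_group S) G" "Poly_Mapping.keys x \<subseteq> S" "Poly_Mapping.keys y \<subseteq> S"
    for k x y
  proof -
    interpret k: group_hom "free_Abelian_group S" G k
      using assms that by (simp add: group_hom_def group_hom_axioms_def)
    show ?thesis
      using k.hom_mult[of x "- y"] k.hom_inv[of y] that by simp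
  qed
  show ?thesis
    using x
  proof (rule free_Abelian_group_induct)
    show "h 0 = h' 0" using h.hom_one h'.hom_one by simp
  qed (simp_all add: diff assms)
qed

lemma frag_extend_hom:
  assumes "\<And>s. s \<in> S \<Longrightarrow> Poly_Mapping.keys (f s) \<subseteq> T"
  shows "frag_extend f \<in> hom (free_Abelian_group S) (free_Abelian_group T)"
proof (rule homI)
  fix x assume "x \<in> carrier (free_Abelian_group S)"
  then show "frag_extend f x \<in> carrier (free_Abelian_group T)"
    using keys_frag_extend[of f x] assms by fastforce
qed (simp add: frag_extend_add)

text \<open>
  The record type of \<^term>\<open>add_monoid M\<close> depends on that of \<open>M\<close>. The additive groups of modules over
  different rings, or the plain monoid record from which a module was built, therefore cannot be
  equated, although their operations coincide; this transfers the group laws between them.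
\<close>

lemma comm_group_cong:
  assumes "comm_group G" "carrier H = carrier G" "monoid.mult H = monoid.mult G" "\<one>\<^bsub>H\<^esub> = \<one>\<^bsub>G\<^esub>"
  shows "comm_group H"
proof -
  interpret G: comm_group G by fact
  show ?thesis
    by (rule comm_groupI) (use assms G.l_inv_ex in \<open>auto simp: G.m_assoc intro: G.m_comm\<close>)
qed

section \<open>Module homomorphisms and restriction of scalars\<close>

lemma left_module_add_hom:
  assumes "left_module A M" "a \<in> carrier A"
  shows "smult M a \<in> hom (add_monoid M) (add_monoid M)"
  using assms by (auto intro!: homI simp: left_module.smult_closed left_module.smult_r_distr)

lemma lmod_hom_add_hom:
  "f \<in> lmod_hom A M N \<Longrightarrow> f \<in> hom (add_monoid M) (add_monoid N)"
  by (auto intro!: homI simp: lmod_hom_def)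

lemma lmod_hom_comp:
  "\<lbrakk>f \<in> lmod_hom A M N; g \<in> lmod_hom A N P\<rbrakk> \<Longrightarrow> g \<circ> f \<in> lmod_hom A M P"
  by (auto simp: lmod_hom_def Pi_iff)

lemma lmod_hom_id: "(\<lambda>x. x) \<in> lmod_hom A M M"
  by (auto simp: lmod_hom_def)

lemma lmod_isomorphicI:
  assumes "left_module A M" "left_module A N"
    and "f \<in> lmod_hom A M N" "g \<in> lmod_hom A N M"
    and "\<And>x. x \<in> carrier M \<Longrightarrow> g (f x) = x" "\<And>y. y \<in> carrier N \<Longrightarrow> f (g y) = y"
  shows "lmod_isomorphic A M N"
proof -
  have "bij_betw f (carrier M) (carrier N)"
    using assms by (intro bij_betw_byWitness[where f' = g]) (auto simp: lmod_hom_def)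
  then show ?thesis
    using assms by (auto simp: lmod_isomorphic_def)
qed

lemma res_mod_sel [simp]:
  "carrier (res_mod \<alpha> V) = carrier V"
  "ring.zero (res_mod \<alpha> V) = ring.zero V"
  "ring.add (res_mod \<alpha> V) = ring.add V"
  "smult (res_mod \<alpha> V) a v = \<alpha> a \<odot>\<^bsub>V\<^esub> v"
  by (simp_all add: res_mod_def)

lemma res_mod_comp: "res_mod \<alpha> (res_mod \<beta> W) = res_mod (\<beta> \<circ> \<alpha>) W"
  by (simp add: res_mod_def)

lemma left_module_res_mod:
  assumes "ring A" "\<alpha> \<in> ring_hom A B" "left_module B V"
  shows "left_module A (res_mod \<alpha> V)"
proof -
  interpret A: ring A by fact
  interpret V: left_module B V by fact
  have "abelian_group (res_mod \<alpha> V)"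
    by (intro comm_group_abelian_groupI comm_group_cong[OF V.M.a_comm_group]) simp_all
  moreover have "left_module_axioms A (res_mod \<alpha> V)"
    using assms(2)
    by unfold_locales
      (auto simp: ring_hom_closed ring_hom_add ring_hom_mult ring_hom_one
        V.smult_closed V.smult_l_distr V.smult_r_distr V.smult_assoc V.smult_one)
  ultimately show ?thesis
    by (intro left_module.intro A.ring_axioms)
qed

lemma lmod_hom_res_mod:
  assumes "\<alpha> \<in> ring_hom A B" "f \<in> lmod_hom B V V'"
  shows "f \<in> lmod_hom A (res_mod \<alpha> V) (res_mod \<alpha> V')"
  using assms by (auto simp: lmod_hom_def ring_hom_closed)

section \<open>Extension of scalars\<close>

locale scalar_extension = left_module A U + B: ring B
  for A :: "('a, 'k) ring_scheme" and U :: "('a, 'u) module" and B :: "('b, 'l) ring_scheme" +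
  fixes \<alpha> :: "'a \<Rightarrow> 'b"
  assumes hom: "\<alpha> \<in> ring_hom A B"
begin

abbreviation F :: "('b \<times> 'u \<Rightarrow>\<^sub>0 int) monoid"
  where "F \<equiv> free_Abelian_group (carrier B \<times> carrier U)"

abbreviation K :: "('b \<times> 'u \<Rightarrow>\<^sub>0 int) set"
  where "K \<equiv> tensor_kernel A B (\<lambda>b a. b \<otimes>\<^bsub>B\<^esub> \<alpha> a) U"

abbreviation I :: "('b, ('b \<times> 'u \<Rightarrow>\<^sub>0 int) set) module"
  where "I \<equiv> ind_mod A B \<alpha> U"

abbreviation coset :: "('b \<times> 'u \<Rightarrow>\<^sub>0 int) \<Rightarrow> ('b \<times> 'u \<Rightarrow>\<^sub>0 int) set"
  where "coset x \<equiv> K #>\<^bsub>F\<^esub> x"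

definition tensor :: "'b \<Rightarrow> 'u \<Rightarrow> ('b \<times> 'u \<Rightarrow>\<^sub>0 int) set"
  where "tensor b u = coset (frag_of (b, u))"

definition left_mult :: "'b \<Rightarrow> ('b \<times> 'u \<Rightarrow>\<^sub>0 int) \<Rightarrow> ('b \<times> 'u \<Rightarrow>\<^sub>0 int)"
  where "left_mult b = frag_extend (\<lambda>(b', u). frag_of (b \<otimes>\<^bsub>B\<^esub> b', u))"

lemma hom_closed [simp]: "a \<in> carrier A \<Longrightarrow> \<alpha> a \<in> carrier B"
  using hom by (rule ring_hom_closed)

lemma relations_subset: "tensor_relations A B (\<lambda>b a. b \<otimes>\<^bsub>B\<^esub> \<alpha> a) U \<subseteq> carrier F"
  by (auto simp: tensor_relations_def smult_closed
      dest!: subsetD[OF keys_diff])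

lemma subgroup_K: "subgroup K F"
  unfolding tensor_kernel_def
  by (rule group.generate_is_subgroup[OF group_free_Abelian_group relations_subset])

lemma normal_K: "K \<lhd> F"
  by (rule comm_group.subgroup_imp_normal[OF abelian_free_Abelian_group subgroup_K])

lemma coset_hom: "coset \<in> hom F (F Mod K)"
  by (rule normal.r_coset_hom_Mod[OF normal_K])

lemma relation_imp_coset_eq:
  assumes "x - y \<in> tensor_relations A B (\<lambda>b a. b \<otimes>\<^bsub>B\<^esub> \<alpha> a) U"
    and "x \<in> carrier F" "y \<in> carrier F"
  shows "coset x = coset y"
proof -
  have "x \<otimes>\<^bsub>F\<^esub> inv\<^bsub>F\<^esub> y \<in> K"
    using assms by (auto simp: tensor_kernel_def intro: generate.incl)
  then have "x \<in> coset y"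
    using assms subgroup.rcos_module_rev[OF subgroup_K group_free_Abelian_group] by blast
  then show ?thesis
    using group.repr_independence[OF group_free_Abelian_group _ _ subgroup_K] assms by blast
qed

lemma ind_mod_sel [simp]:
  "carrier I = carrier (F Mod K)"
  "ring.zero I = K"
  "ring.add I = monoid.mult (F Mod K)"
  by (simp_all add: ind_mod_def tensor_group_def Let_def)

text \<open>
  The two groups differ in their record extensions only, which homomorphisms do not see.
\<close>

lemma hom_add_monoid_ind_mod:
  "hom G (add_monoid I) = hom G (F Mod K)" "hom (add_monoid I) H = hom (F Mod K) H"
  by (simp_all add: hom_def)

lemma carrier_ind_mod_cases:
  assumes "X \<in> carrier I"
  obtains x where "x \<in> carrier F" "X = coset x"
  using assms by (auto simp: carrier_FactGroup)

lemma coset_closed: "x \<in> carrier F \<Longrightarrow> coset x \<in> carrier I"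
  by (auto simp: carrier_FactGroup)

lemma coset_add:
  "\<lbrakk>x \<in> carrier F; y \<in> carrier F\<rbrakk> \<Longrightarrow> coset (x + y) = coset x \<oplus>\<^bsub>I\<^esub> coset y"
  using hom_mult[OF coset_hom] by simp

lemma abelian_group_ind_mod: "abelian_group I"
  by (intro comm_group_abelian_groupI comm_group_cong[OF
        comm_group.abelian_FactGroup[OF abelian_free_Abelian_group subgroup_K]]) simp_all

lemma tensor_closed: "\<lbrakk>b \<in> carrier B; u \<in> carrier U\<rbrakk> \<Longrightarrow> tensor b u \<in> carrier I"
  unfolding tensor_def by (rule coset_closed) simp

lemma tensor_add_left:
  assumes "b \<in> carrier B" "b' \<in> carrier B" "u \<in> carrier U"
  shows "tensor (b \<oplus>\<^bsub>B\<^esub> b') u = tensor b u \<oplus>\<^bsub>I\<^esub> tensor b' u"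
proof -
  have "coset (frag_of (b \<oplus>\<^bsub>B\<^esub> b', u)) = coset (frag_of (b, u) + frag_of (b', u))"
    using assms by (intro relation_imp_coset_eq)
      (auto simp: tensor_relations_def diff_diff_eq[symmetric] dest!: subsetD[OF keys_add])
  then show ?thesis
    using assms by (simp add: tensor_def coset_add del: ind_mod_sel)
qed

lemma tensor_add_right:
  assumes "b \<in> carrier B" "u \<in> carrier U" "u' \<in> carrier U"
  shows "tensor b (u \<oplus>\<^bsub>U\<^esub> u') = tensor b u \<oplus>\<^bsub>I\<^esub> tensor b u'"
proof -
  have "coset (frag_of (b, u \<oplus>\<^bsub>U\<^esub> u')) = coset (frag_of (b, u) + frag_of (b, u'))"
    using assms by (intro relation_imp_coset_eq)
      (auto simp: tensor_relations_def diff_diff_eq[symmetric] dest!: subsetD[OF keys_add])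
  then show ?thesis
    using assms by (simp add: tensor_def coset_add del: ind_mod_sel)
qed

lemma tensor_balanced:
  assumes "b \<in> carrier B" "a \<in> carrier A" "u \<in> carrier U"
  shows "tensor (b \<otimes>\<^bsub>B\<^esub> \<alpha> a) u = tensor b (a \<odot>\<^bsub>U\<^esub> u)"
  unfolding tensor_def using assms
  by (intro relation_imp_coset_eq) (auto simp: tensor_relations_def smult_closed)

text \<open>
  The universal property of the tensor product at the level of the free group: the hypotheses say that
  \<open>h\<close> maps every relation to the neutral element, and the kernel of \<open>h\<close> is a subgroup, so it contains
  the subgroup that the relations generate.
\<close>

lemma balanced_imp_K_subset_kernel:
  assumes "group G" and h: "h \<in> hom F G"
    and add_left: "\<And>b b' u. \<lbrakk>b \<in> carrier B; b' \<in> carrier B; u \<in> carrier U\<rbrakk>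
      \<Longrightarrow> h (frag_of (b \<oplus>\<^bsub>B\<^esub> b', u)) = h (frag_of (b, u)) \<otimes>\<^bsub>G\<^esub> h (frag_of (b', u))"
    and add_right: "\<And>b u u'. \<lbrakk>b \<in> carrier B; u \<in> carrier U; u' \<in> carrier U\<rbrakk>
      \<Longrightarrow> h (frag_of (b, u \<oplus>\<^bsub>U\<^esub> u')) = h (frag_of (b, u)) \<otimes>\<^bsub>G\<^esub> h (frag_of (b, u'))"
    and balanced: "\<And>b a u. \<lbrakk>b \<in> carrier B; a \<in> carrier A; u \<in> carrier U\<rbrakk>
      \<Longrightarrow> h (frag_of (b \<otimes>\<^bsub>B\<^esub> \<alpha> a, u)) = h (frag_of (b, a \<odot>\<^bsub>U\<^esub> u))"
  shows "K \<subseteq> kernel F G h"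
proof -
  interpret h: group_hom F G h
    using assms by (simp add: group_hom_def group_hom_axioms_def)
  have kernelI: "x - y \<in> kernel F G h"
    if "x \<in> carrier F" "y \<in> carrier F" "h x = h y" for x y
  proof -
    have "h (x - y) = h x \<otimes>\<^bsub>G\<^esub> inv\<^bsub>G\<^esub> h y"
      using h.hom_mult[of x "- y"] h.hom_inv[of y] that by simp
    moreover have "x - y \<in> carrier F"
      using that keys_diff[of x y] by auto
    moreover have "h y \<in> carrier G"
      using that(2) by (rule h.hom_closed)
    ultimately show ?thesis
      using that by (simp add: kernel_def)
  qed
  have sum: "frag_of p + frag_of q \<in> carrier F"
    "h (frag_of p + frag_of q) = h (frag_of p) \<otimes>\<^bsub>G\<^esub> h (frag_of q)"
    if "p \<in> carrier B \<times> carrier U" "q \<in> carrier B \<times> carrier U" for p q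
    using that h.hom_mult[of "frag_of p" "frag_of q"] keys_add[of "frag_of p" "frag_of q"] by auto
  have "tensor_relations A B (\<lambda>b a. b \<otimes>\<^bsub>B\<^esub> \<alpha> a) U \<subseteq> kernel F G h"
    unfolding tensor_relations_def diff_diff_eq
    by (auto intro!: kernelI sum(1) simp: sum(2) add_left add_right balanced smult_closed simp del: carrier_free_Abelian_group_iff)
  then show ?thesis
    unfolding tensor_kernel_def
    by (rule h.G.generate_subgroup_incl[OF _ h.subgroup_kernel])
qed

lemma left_mult_frag_of [simp]: "left_mult b (frag_of (b', u)) = frag_of (b \<otimes>\<^bsub>B\<^esub> b', u)"
  by (simp add: left_mult_def)

lemma left_mult_hom: "b \<in> carrier B \<Longrightarrow> left_mult b \<in> hom F F"
  unfolding left_mult_def by (rule frag_extend_hom) auto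

lemma left_mult_closed: "\<lbrakk>b \<in> carrier B; x \<in> carrier F\<rbrakk> \<Longrightarrow> left_mult b x \<in> carrier F"
  by (rule hom_in_carrier[OF left_mult_hom])

lemma coset_left_mult_hom: "b \<in> carrier B \<Longrightarrow> coset \<circ> left_mult b \<in> hom F (add_monoid I)"
  unfolding hom_add_monoid_ind_mod by (rule hom_compose[OF left_mult_hom coset_hom])

text \<open>
  Left multiplication by \<open>b\<close> commutes with the right action of \<open>A\<close> on \<open>B\<close> by associativity, so the map
  \<open>(b', u) \<mapsto> b b' \<otimes> u\<close> is again balanced.
\<close>

lemma left_mult_K:
  assumes "b \<in> carrier B" "k \<in> K"
  shows "left_mult b k \<in> K"
proof -
  interpret I: abelian_group I by (rule abelian_group_ind_mod)
  have "K \<subseteq> kernel F (add_monoid I) (coset \<circ> left_mult b)"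
    using assms(1)
    by (intro balanced_imp_K_subset_kernel I.a_group coset_left_mult_hom)
      (simp_all add: tensor_def[symmetric] B.r_distr tensor_add_left tensor_add_right
        B.m_assoc[symmetric] tensor_balanced smult_closed del: ind_mod_sel)
  then have k: "k \<in> carrier F" "coset (left_mult b k) = K"
    using assms(2) by (auto simp: kernel_def)
  then show ?thesis
    using group.rcos_self[OF group_free_Abelian_group left_mult_closed[OF assms(1) k(1)] subgroup_K]
    by simp
qed

text \<open>
  Since left multiplication preserves the kernel, the set-level action of \<^const>\<open>ind_mod\<close>, which
  adds the kernel back to an image, can be computed on any representative.
\<close>

lemma smult_coset:
  assumes b: "b \<in> carrier B" and x: "x \<in> carrier F"
  shows "b \<odot>\<^bsub>I\<^esub> coset x = coset (left_mult b x)"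
proof -
  have "b \<odot>\<^bsub>I\<^esub> coset x = K <#>\<^bsub>F\<^esub> left_mult b ` coset x"
    by (simp add: ind_mod_def Let_def left_mult_def)
  also have "\<dots> = coset (left_mult b x)"
  proof (intro equalityI subsetI)
    fix y assume "y \<in> K <#>\<^bsub>F\<^esub> left_mult b ` coset x"
    then obtain k k' where k: "k \<in> K" "k' \<in> K" "y = k + left_mult b (k' + x)"
      by (auto simp: set_mult_def r_coset_def)
    then have "y = (k \<otimes>\<^bsub>F\<^esub> left_mult b k') \<otimes>\<^bsub>F\<^esub> left_mult b x"
      by (simp add: left_mult_def frag_extend_add add.assoc)
    moreover have "k \<otimes>\<^bsub>F\<^esub> left_mult b k' \<in> K"
      using k left_mult_K[OF b] subgroup.m_closed[OF subgroup_K] by blast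
    ultimately show "y \<in> coset (left_mult b x)"
      by (auto simp: r_coset_def)
  next
    fix y assume "y \<in> coset (left_mult b x)"
    then obtain k where "k \<in> K" "y = k \<otimes>\<^bsub>F\<^esub> left_mult b x"
      by (auto simp: r_coset_def)
    moreover have "x \<in> coset x"
      by (rule group.rcos_self[OF group_free_Abelian_group x subgroup_K])
    ultimately show "y \<in> K <#>\<^bsub>F\<^esub> left_mult b ` coset x"
      by (auto simp: set_mult_def)
  qed
  finally show ?thesis .
qed

lemma smult_tensor:
  "\<lbrakk>b \<in> carrier B; b' \<in> carrier B; u \<in> carrier U\<rbrakk> \<Longrightarrow> b \<odot>\<^bsub>I\<^esub> tensor b' u = tensor (b \<otimes>\<^bsub>B\<^esub> b') u"
  by (simp add: tensor_def smult_coset)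

text \<open>
  The pure tensors generate the induced module as an abelian group, since the \<open>frag_of (b, u)\<close>
  generate the free group above it.
\<close>

lemma additive_eqI:
  assumes "group G" "h \<in> hom (add_monoid I) G" "h' \<in> hom (add_monoid I) G"
    and eq: "\<And>b u. \<lbrakk>b \<in> carrier B; u \<in> carrier U\<rbrakk> \<Longrightarrow> h (tensor b u) = h' (tensor b u)"
    and "X \<in> carrier I"
  shows "h X = h' X"
proof -
  obtain x where x: "x \<in> carrier F" "X = coset x"
    using assms(5) by (rule carrier_ind_mod_cases)
  have "(h \<circ> coset) x = (h' \<circ> coset) x"
  proof (rule hom_free_Abelian_group_eqI[OF \<open>group G\<close>])
    show "h \<circ> coset \<in> hom F G" "h' \<circ> coset \<in> hom F G"
      using assms(2,3) coset_hom unfolding hom_add_monoid_ind_mod by (auto intro: hom_compose)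
  qed (use x eq in \<open>auto simp: tensor_def\<close>)
  then show ?thesis
    using x by simp
qed

lemma smult_add_hom:
  assumes b: "b \<in> carrier B"
  shows "smult I b \<in> hom (add_monoid I) (add_monoid I)"
proof -
  have add: "left_mult b (x + y) = left_mult b x + left_mult b y" for x y
    by (simp add: left_mult_def frag_extend_add)
  show ?thesis
  proof (rule homI)
    fix X assume "X \<in> carrier (add_monoid I)"
    then have "X \<in> carrier I" by simp
    then obtain x where "x \<in> carrier F" "X = coset x"
      by (rule carrier_ind_mod_cases)
    then show "b \<odot>\<^bsub>I\<^esub> X \<in> carrier (add_monoid I)"
      using b coset_closed[OF left_mult_closed] by (simp add: smult_coset)
  next
    fix X Y assume "X \<in> carrier (add_monoid I)" "Y \<in> carrier (add_monoid I)"
    then obtain x y where xy: "x \<in> carrier F" "X = coset x" "y \<in> carrier F" "Y = coset y"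
      by (auto simp: carrier_FactGroup)
    have "x + y \<in> carrier F"
      using xy keys_add[of x y] by auto
    then show "b \<odot>\<^bsub>I\<^esub> (X \<otimes>\<^bsub>add_monoid I\<^esub> Y) = (b \<odot>\<^bsub>I\<^esub> X) \<otimes>\<^bsub>add_monoid I\<^esub> (b \<odot>\<^bsub>I\<^esub> Y)"
      using b xy left_mult_closed[OF b]
      by (simp add: coset_add[symmetric] smult_coset add
          del: ind_mod_sel carrier_free_Abelian_group_iff)
  qed
qed

text \<open>
  Distributivity over sums of module elements is built into the action. Both sides of the laws for
  sums and products of scalars and for the unit scalar are additive in
  the module element, so it suffices to compare them on pure tensors, where they reduce to the
  corresponding laws of the ring \<open>B\<close>.
\<close>

lemma left_module_ind_mod: "left_module B I"
proof (rule left_module.intro[OF B.ring_axioms abelian_group_ind_mod], unfold_locales)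
  interpret I: abelian_group I by (rule abelian_group_ind_mod)
  note add_eqI = additive_eqI[OF I.a_group]
  show closed: "b \<odot>\<^bsub>I\<^esub> X \<in> carrier I" if "b \<in> carrier B" "X \<in> carrier I" for b X
    using hom_in_carrier[OF smult_add_hom] that by fastforce
  show distr: "b \<odot>\<^bsub>I\<^esub> (X \<oplus>\<^bsub>I\<^esub> Y) = b \<odot>\<^bsub>I\<^esub> X \<oplus>\<^bsub>I\<^esub> b \<odot>\<^bsub>I\<^esub> Y"
    if "b \<in> carrier B" "X \<in> carrier I" "Y \<in> carrier I" for b X Y
    using hom_mult[OF smult_add_hom] that by fastforce
  show "(b \<oplus>\<^bsub>B\<^esub> c) \<odot>\<^bsub>I\<^esub> X = b \<odot>\<^bsub>I\<^esub> X \<oplus>\<^bsub>I\<^esub> c \<odot>\<^bsub>I\<^esub> X"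
    if "b \<in> carrier B" "c \<in> carrier B" "X \<in> carrier I" for b c X
  proof (rule add_eqI[OF _ _ _ \<open>X \<in> carrier I\<close>])
    show "smult I (b \<oplus>\<^bsub>B\<^esub> c) \<in> hom (add_monoid I) (add_monoid I)"
      using that by (simp add: smult_add_hom del: ind_mod_sel)
    show "(\<lambda>X. b \<odot>\<^bsub>I\<^esub> X \<oplus>\<^bsub>I\<^esub> c \<odot>\<^bsub>I\<^esub> X) \<in> hom (add_monoid I) (add_monoid I)"
      using that by (intro homI) (simp_all add: closed distr I.a_ac del: ind_mod_sel)
  qed (use that in \<open>simp add: smult_tensor tensor_add_left B.l_distr del: ind_mod_sel\<close>)
  show "(b \<otimes>\<^bsub>B\<^esub> c) \<odot>\<^bsub>I\<^esub> X = b \<odot>\<^bsub>I\<^esub> (c \<odot>\<^bsub>I\<^esub> X)"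
    if "b \<in> carrier B" "c \<in> carrier B" "X \<in> carrier I" for b c X
  proof (rule add_eqI[OF _ _ _ \<open>X \<in> carrier I\<close>])
    show "smult I (b \<otimes>\<^bsub>B\<^esub> c) \<in> hom (add_monoid I) (add_monoid I)"
      using that by (simp add: smult_add_hom del: ind_mod_sel)
    show "(\<lambda>X. b \<odot>\<^bsub>I\<^esub> (c \<odot>\<^bsub>I\<^esub> X)) \<in> hom (add_monoid I) (add_monoid I)"
      using that by (intro homI) (simp_all add: closed distr del: ind_mod_sel)
  qed (use that in \<open>simp add: smult_tensor B.m_assoc del: ind_mod_sel\<close>)
  show "\<one>\<^bsub>B\<^esub> \<odot>\<^bsub>I\<^esub> X = X" if "X \<in> carrier I" for X
  proof (rule add_eqI[OF _ _ _ that])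
    show "(\<lambda>X. X) \<in> hom (add_monoid I) (add_monoid I)"
      by (simp add: hom_def)
  qed (simp_all add: smult_add_hom smult_tensor del: ind_mod_sel)
qed

text \<open>The unit of the adjunction between induction and restriction.\<close>

definition unit :: "'u \<Rightarrow> ('b \<times> 'u \<Rightarrow>\<^sub>0 int) set"
  where "unit u = tensor \<one>\<^bsub>B\<^esub> u"

text \<open>
  Here the balancing relation is used: \<open>1 \<otimes> a u = \<alpha>(a) \<otimes> u = \<alpha>(a) (1 \<otimes> u)\<close>.
\<close>

lemma unit_lmod_hom: "unit \<in> lmod_hom A U (res_mod \<alpha> I)"
proof -
  have "tensor \<one>\<^bsub>B\<^esub> (a \<odot>\<^bsub>U\<^esub> u) = \<alpha> a \<odot>\<^bsub>I\<^esub> tensor \<one>\<^bsub>B\<^esub> u" if "a \<in> carrier A" "u \<in> carrier U" for a u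
    using that tensor_balanced[of "\<one>\<^bsub>B\<^esub>" a u] by (simp add: smult_tensor)
  then show ?thesis
    by (auto simp: lmod_hom_def unit_def tensor_closed tensor_add_right simp del: ind_mod_sel)
qed

text \<open>
  Uniqueness in the adjunction: as \<open>b \<otimes> u = b (1 \<otimes> u)\<close>, the image of the unit generates the induced
  module over \<open>B\<close>.
\<close>

lemma lmod_hom_ind_mod_eqI:
  assumes "left_module B V" and f: "f \<in> lmod_hom B I V" and g: "g \<in> lmod_hom B I V"
    and eq: "\<And>u. u \<in> carrier U \<Longrightarrow> f (unit u) = g (unit u)"
    and X: "X \<in> carrier I"
  shows "f X = g X"
proof (rule additive_eqI[OF _ lmod_hom_add_hom[OF f] lmod_hom_add_hom[OF g] _ X])
  interpret V: left_module B V by fact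
  show "group (add_monoid V)" by (rule V.M.a_group)
  fix b u assume bu: "b \<in> carrier B" "u \<in> carrier U"
  then have u: "unit u \<in> carrier I"
    by (simp add: unit_def tensor_closed del: ind_mod_sel)
  have "tensor b u = b \<odot>\<^bsub>I\<^esub> unit u"
    using bu by (simp add: unit_def smult_tensor)
  moreover have "f (b \<odot>\<^bsub>I\<^esub> unit u) = b \<odot>\<^bsub>V\<^esub> f (unit u)" "g (b \<odot>\<^bsub>I\<^esub> unit u) = b \<odot>\<^bsub>V\<^esub> g (unit u)"
    using f g bu(1) u by (auto simp: lmod_hom_def simp del: ind_mod_sel)
  ultimately show "f (tensor b u) = g (tensor b u)"
    using eq bu(2) by simp
qed

text \<open>
  Existence in the adjunction. The extension is \<open>b \<otimes> u \<mapsto> b \<phi>(u)\<close>, which is balanced because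
  \<open>b (\<alpha>(a) \<phi>(u)) = b \<phi>(a u)\<close> by the linearity of \<open>\<phi>\<close>.
\<close>

lemma lmod_hom_extends:
  assumes "left_module B V" and \<phi>: "\<phi> \<in> lmod_hom A U (res_mod \<alpha> V)"
  obtains h where "h \<in> lmod_hom B I V" "\<And>u. u \<in> carrier U \<Longrightarrow> h (unit u) = \<phi> u"
proof -
  interpret V: left_module B V by fact
  have \<phi>_closed: "\<phi> u \<in> carrier V" if "u \<in> carrier U" for u
    using \<phi> that by (auto simp: lmod_hom_def)
  have \<phi>_add: "\<phi> (u \<oplus>\<^bsub>U\<^esub> u') = \<phi> u \<oplus>\<^bsub>V\<^esub> \<phi> u'" if "u \<in> carrier U" "u' \<in> carrier U" for u u'
    using \<phi> that by (auto simp: lmod_hom_def)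
  have \<phi>_smult: "\<phi> (a \<odot>\<^bsub>U\<^esub> u) = \<alpha> a \<odot>\<^bsub>V\<^esub> \<phi> u" if "a \<in> carrier A" "u \<in> carrier U" for a u
    using \<phi> that by (auto simp: lmod_hom_def)
  have "(\<lambda>(b, u). b \<odot>\<^bsub>V\<^esub> \<phi> u) ` (carrier B \<times> carrier U) \<subseteq> carrier (add_monoid V)"
    by (auto simp: V.smult_closed \<phi>_closed)
  then obtain h0 where h0: "h0 \<in> hom F (add_monoid V)"
    and h0': "\<And>x. x \<in> carrier B \<times> carrier U \<Longrightarrow> h0 (frag_of x) = (\<lambda>(b, u). b \<odot>\<^bsub>V\<^esub> \<phi> u) x"
    using comm_group.free_Abelian_group_universal[OF V.M.a_comm_group] by blast
  interpret h0: group_hom F "add_monoid V" h0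
    using h0 V.M.a_group by (simp add: group_hom_def group_hom_axioms_def)
  have "K \<subseteq> kernel F (add_monoid V) h0"
    by (intro balanced_imp_K_subset_kernel V.M.a_group h0)
      (simp_all add: h0' V.smult_l_distr V.smult_r_distr V.smult_assoc \<phi>_closed \<phi>_add \<phi>_smult
        smult_closed)
  then obtain h where h: "h \<in> hom (F Mod K) (add_monoid V)"
    and h': "\<And>x. x \<in> carrier F \<Longrightarrow> h (coset x) = h0 x"
    using h0.FactGroup_universal_kernel[OF normal_K] by blast
  have h_add: "h \<in> hom (add_monoid I) (add_monoid V)"
    unfolding hom_add_monoid_ind_mod by (rule h)
  have h_tensor: "h (tensor b u) = b \<odot>\<^bsub>V\<^esub> \<phi> u" if "b \<in> carrier B" "u \<in> carrier U" for b u
    using that by (simp add: tensor_def h' h0')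
  have linear: "h (b \<odot>\<^bsub>I\<^esub> X) = b \<odot>\<^bsub>V\<^esub> h X" if b: "b \<in> carrier B" and X: "X \<in> carrier I" for b X
  proof -
    have "(h \<circ> smult I b) X = (smult V b \<circ> h) X"
    proof (rule additive_eqI[OF V.M.a_group _ _ _ X])
      show "h \<circ> smult I b \<in> hom (add_monoid I) (add_monoid V)"
        by (rule hom_compose[OF smult_add_hom[OF b] h_add])
      show "smult V b \<circ> h \<in> hom (add_monoid I) (add_monoid V)"
        by (rule hom_compose[OF h_add left_module_add_hom[OF assms(1) b]])
    qed (simp add: b smult_tensor h_tensor V.smult_assoc \<phi>_closed)
    then show ?thesis by simp
  qed
  show thesis
  proof
    show "h \<in> lmod_hom B I V"
      using h_add linear by (auto simp: lmod_hom_def hom_def)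
    show "h (unit u) = \<phi> u" if "u \<in> carrier U" for u
      using that by (simp add: unit_def h_tensor V.smult_one \<phi>_closed)
  qed
qed

end

section \<open>Induction in stages\<close>

text \<open>
  Both modules solve the same universal problem, so the maps obtained by extending each unit along
  the other compose to endomorphisms that fix the units, and these are identities.
\<close>

lemma ind_mod_comp:
  fixes A :: "('a, 'k) ring_scheme" and B :: "('b, 'l) ring_scheme" and C :: "('c, 'n) ring_scheme"
    and U :: "('a, 'u) module"
  assumes "left_module A U" "ring B" "ring C"
    and \<alpha>: "\<alpha> \<in> ring_hom A B" and \<beta>: "\<beta> \<in> ring_hom B C"
  shows "lmod_isomorphic C (ind_mod B C \<beta> (ind_mod A B \<alpha> U)) (ind_mod A C (\<beta> \<circ> \<alpha>) U)"
proof -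
  have \<beta>\<alpha>: "\<beta> \<circ> \<alpha> \<in> ring_hom A C"
    by (rule ring_hom_trans[OF \<alpha> \<beta>])
  interpret AB: scalar_extension A U B \<alpha>
    using assms by (simp add: scalar_extension_def scalar_extension_axioms_def)
  interpret BC: scalar_extension B "ind_mod A B \<alpha> U" C \<beta>
    using assms AB.left_module_ind_mod
    by (simp add: scalar_extension_def scalar_extension_axioms_def)
  interpret AC: scalar_extension A U C "\<beta> \<circ> \<alpha>"
    using assms \<beta>\<alpha> by (simp add: scalar_extension_def scalar_extension_axioms_def)
  \<comment> \<open>The induced modules are treated abstractly from here on, through their universal property.\<close>
  note AB.ind_mod_sel[simp del] BC.ind_mod_sel[simp del] AC.ind_mod_sel[simp del]
  have unit_AB: "AB.unit u \<in> carrier AB.I" if "u \<in> carrier U" for u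
    using AB.unit_lmod_hom that by (auto simp: lmod_hom_def)
  have res_module: "left_module B (res_mod \<beta> V)" if "left_module C V" for V :: "('c, 'v) module"
    using assms that by (intro left_module_res_mod)

  \<comment> \<open>The extension \<open>\<psi>\<close> is \<open>b \<otimes> u \<mapsto> \<beta>(b) \<otimes> u\<close>, and \<open>f\<close> is \<open>c \<otimes> (b \<otimes> u) \<mapsto> c \<beta>(b) \<otimes> u\<close>.\<close>
  have "AC.unit \<in> lmod_hom A U (res_mod \<alpha> (res_mod \<beta> AC.I))"
    unfolding res_mod_comp by (rule AC.unit_lmod_hom)
  then obtain \<psi> where \<psi>: "\<psi> \<in> lmod_hom B AB.I (res_mod \<beta> AC.I)"
    and \<psi>_unit: "\<And>u. u \<in> carrier U \<Longrightarrow> \<psi> (AB.unit u) = AC.unit u"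
    using AB.lmod_hom_extends[OF res_module[OF AC.left_module_ind_mod]] by blast
  obtain f where f: "f \<in> lmod_hom C BC.I AC.I"
    and f_unit: "\<And>X. X \<in> carrier AB.I \<Longrightarrow> f (BC.unit X) = \<psi> X"
    using BC.lmod_hom_extends[OF AC.left_module_ind_mod \<psi>] by blast

  \<comment> \<open>The extension \<open>g\<close> is \<open>c \<otimes> u \<mapsto> c \<otimes> (1 \<otimes> u)\<close>.\<close>
  have "BC.unit \<circ> AB.unit \<in> lmod_hom A U (res_mod (\<beta> \<circ> \<alpha>) BC.I)"
    unfolding res_mod_comp[symmetric]
    by (rule lmod_hom_comp[OF AB.unit_lmod_hom lmod_hom_res_mod[OF \<alpha> BC.unit_lmod_hom]])
  then obtain g where g: "g \<in> lmod_hom C AC.I BC.I"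
    and g_unit: "\<And>u. u \<in> carrier U \<Longrightarrow> g (AC.unit u) = (BC.unit \<circ> AB.unit) u"
    using AC.lmod_hom_extends[OF BC.left_module_ind_mod] by blast

  show ?thesis
  proof (rule lmod_isomorphicI[OF BC.left_module_ind_mod AC.left_module_ind_mod f g])
    fix Y assume Y: "Y \<in> carrier AC.I"
    have "(f \<circ> g) Y = Y"
      by (rule AC.lmod_hom_ind_mod_eqI[OF AC.left_module_ind_mod lmod_hom_comp[OF g f] lmod_hom_id _ Y])
        (simp add: g_unit f_unit[OF unit_AB] \<psi>_unit)
    then show "f (g Y) = Y" by simp
  next
    fix X assume X: "X \<in> carrier BC.I"
    \<comment> \<open>Agreement on the outer unit is an equation between \<open>B\<close>-linear maps on the inner induced module,
      so it is reduced once more, to the inner unit.\<close>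
    have on_units: "(g \<circ> f \<circ> BC.unit) Y = BC.unit Y" if Y: "Y \<in> carrier AB.I" for Y
    proof (rule AB.lmod_hom_ind_mod_eqI[OF res_module[OF BC.left_module_ind_mod] _ BC.unit_lmod_hom _ Y])
      show "g \<circ> f \<circ> BC.unit \<in> lmod_hom B AB.I (res_mod \<beta> BC.I)"
        by (rule lmod_hom_comp[OF BC.unit_lmod_hom lmod_hom_res_mod[OF \<beta> lmod_hom_comp[OF f g]]])
    qed (simp add: f_unit[OF unit_AB] \<psi>_unit g_unit)
    have "(g \<circ> f) X = X"
      by (rule BC.lmod_hom_ind_mod_eqI[OF BC.left_module_ind_mod lmod_hom_comp[OF f g] lmod_hom_id _ X])
        (use on_units in simp)
    then show "g (f X) = X" by simp
  qed
qed

theorem theorem3p1: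
  fixes R :: "'r ring"
    and A :: "('r, 'a) module" and B :: "('r, 'b) module" and C :: "('r, 'c) module"
    and \<alpha> :: "'a \<Rightarrow> 'b" and \<beta> :: "'b \<Rightarrow> 'c"
    and U :: "('a, 'u) module" and W :: "('c, 'w) module"
  assumes "cring R"
    and "assoc_algebra R A" and "assoc_algebra R B" and "assoc_algebra R C"
    and "\<alpha> \<in> alg_hom R A B" and "\<beta> \<in> alg_hom R B C"
    and "left_module A U" and "left_module C W"
  shows
   "lmod_isomorphic A (res_mod \<alpha> (res_mod \<beta> W)) (res_mod (\<beta> \<circ> \<alpha>) W) \<and>
    lmod_isomorphic C (ind_mod B C \<beta> (ind_mod A B \<alpha> U)) (ind_mod A C (\<beta> \<circ> \<alpha>) U)"
proof
  have rings: "ring A" "ring B" "ring C"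
    using assms(2-4) by (auto simp: assoc_algebra_def)
  have homs: "\<alpha> \<in> ring_hom A B" "\<beta> \<in> ring_hom B C"
    using assms(5,6) by (auto simp: alg_hom_def)
  have "left_module A (res_mod (\<beta> \<circ> \<alpha>) W)"
    by (rule left_module_res_mod[OF rings(1) ring_hom_trans[OF homs] assms(8)])
  then show "lmod_isomorphic A (res_mod \<alpha> (res_mod \<beta> W)) (res_mod (\<beta> \<circ> \<alpha>) W)"
    unfolding res_mod_comp by (intro lmod_isomorphicI[OF _ _ lmod_hom_id lmod_hom_id] refl)
  show "lmod_isomorphic C (ind_mod B C \<beta> (ind_mod A B \<alpha> U)) (ind_mod A C (\<beta> \<circ> \<alpha>) U)"
    by (rule ind_mod_comp[OF assms(7) rings(2,3) homs])
qed

end
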